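(* Let $\mathcal{I}$ be a tall $F_\sigma$ P-ideal on $\omega$. Then $\mathcal{I}$ is representable in $c_0$ if and only if $\mathcal{I}$ is a summable ideal.
   Context: An ideal on $\omega$ is a proper ideal of subsets of $\omega$ containing all finite sets. It is $F_\sigma$ if it is an $F_\sigma$ subset of $2^\omega$; a P-ideal if for every countable $\mathcal{C}\subseteq\mathcal{I}$ there is $A\in\mathcal{I}$ with $C\setminus A$ finite for all $C\in\mathcal{C}$; tall if every infinite subset of $\omega$ contains an infinite element of $\mathcal{I}$. It is a summable ideal if there is $m\colon\omega\to[0,\infty)$ with $\sum_{i\in\omega}m(i)=\infty$ such that $\mathcal{I}=\{I\subseteq\omega:\sum_{i\in I}m(i)<\infty\}$. $c_0$ is the Banach space of real null sequences with the sup norm. For $h\colon\omega\to c_0$ with $\sum_{n\in\omega}h(n)$ not unconditionally convergent, let $\mathcal{I}^{c_0}_h=\{A\subseteq\omega:\sum_{n\in A}h(n)$ converges unconditionally in $c_0\}$; an ideal is representable in $c_0$ if it equals $\mathcal{I}^{c_0}_h$ for some such $h$. *)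

theory Defs
  imports "HOL-Analysis.Analysis"
begin

definition ideal_on_omega :: "nat set set \<Rightarrow> bool" where
  "ideal_on_omega \<I> \<longleftrightarrow>
     (\<forall>A\<in>\<I>. \<forall>B. B \<subseteq> A \<longrightarrow> B \<in> \<I>) \<and>
     (\<forall>A\<in>\<I>. \<forall>B\<in>\<I>. A \<union> B \<in> \<I>) \<and>
     (\<forall>A. finite A \<longrightarrow> A \<in> \<I>) \<and>
     UNIV \<notin> \<I>"

text \<open>The Cantor space is the type \<open>nat \<Rightarrow> bool\<close> with the library's product topology, \<open>bool\<close> being
  discrete; a family of subsets of \<open>nat\<close> is identified with its set of characteristic functions.\<close>

definition F_sigma_family :: "nat set set \<Rightarrow> bool" where
  "F_sigma_family \<I> \<longleftrightarrow> fsigma ((\<lambda>A n. n \<in> A) ` \<I>)"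

definition P_ideal :: "nat set set \<Rightarrow> bool" where
  "P_ideal \<I> \<longleftrightarrow> ideal_on_omega \<I> \<and>
     (\<forall>\<C>. countable \<C> \<and> \<C> \<subseteq> \<I> \<longrightarrow> (\<exists>A\<in>\<I>. \<forall>C\<in>\<C>. finite (C - A)))"

definition tall :: "nat set set \<Rightarrow> bool" where
  "tall \<I> \<longleftrightarrow> (\<forall>X. infinite X \<longrightarrow> (\<exists>Y\<in>\<I>. infinite Y \<and> Y \<subseteq> X))"

text \<open>For nonnegative \<open>m\<close>, the sum over \<open>A\<close> is finite iff \<open>m summable_on A\<close>.\<close>

definition summable_ideal :: "nat set set \<Rightarrow> bool" where
  "summable_ideal \<I> \<longleftrightarrow>
     (\<exists>m :: nat \<Rightarrow> real. (\<forall>i. 0 \<le> m i) \<and> \<not> m summable_on UNIV \<and> \<I> = {A. m summable_on A})"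

text \<open>Since \<open>nat\<close> is discrete, \<open>nat \<Rightarrow>\<^sub>C real\<close> is the space of all bounded real sequences with the
  sup norm, and \<open>c0\<close> is its closed subspace of null sequences.\<close>

definition c0 :: "(nat \<Rightarrow>\<^sub>C real) set" where
  "c0 = {x. apply_bcontfun x \<longlonglongrightarrow> 0}"

text \<open>Unconditional convergence is convergence of the net of finite partial sums, that is, the
  library's \<open>has_sum\<close>; the limit is required to lie in \<open>c0\<close>.\<close>

definition uncond_convergent_c0 :: "(nat \<Rightarrow> nat \<Rightarrow>\<^sub>C real) \<Rightarrow> nat set \<Rightarrow> bool" where
  "uncond_convergent_c0 h A \<longleftrightarrow> (\<exists>s\<in>c0. (h has_sum s) A)"

definition c0_ideal :: "(nat \<Rightarrow> nat \<Rightarrow>\<^sub>C real) \<Rightarrow> nat set set" where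
  "c0_ideal h = {A. uncond_convergent_c0 h A}"

definition representable_in_c0 :: "nat set set \<Rightarrow> bool" where
  "representable_in_c0 \<I> \<longleftrightarrow>
     (\<exists>h. range h \<subseteq> c0 \<and> \<not> uncond_convergent_c0 h UNIV \<and> \<I> = c0_ideal h)"

lemma in_bcontfun_nat: "(f :: nat \<Rightarrow> real) \<in> bcontfun \<longleftrightarrow> bounded (range f)"
  by (simp add: bcontfun_def continuous_on_discrete)

lemma null_sequence_in_c0:
  assumes "f \<longlonglongrightarrow> (0 :: real)"
  shows "Bcontfun f \<in> c0" "apply_bcontfun (Bcontfun f) = f"
proof -
  have "f \<in> bcontfun"
    using assms convergentI convergent_imp_bounded in_bcontfun_nat by blast
  then show "apply_bcontfun (Bcontfun f) = f"
    by (rule Bcontfun_inverse)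
  with assms show "Bcontfun f \<in> c0"
    by (simp add: c0_def)
qed

lemma norm_eq_SUP_nat: "norm (x :: nat \<Rightarrow>\<^sub>C real) = (SUP n. \<bar>apply_bcontfun x n\<bar>)"
  by (simp add: norm_bcontfun_def dist_bcontfun.rep_eq)

end

theory Submission
  imports Defs
begin

text \<open>Suppose that \<open>h\<close> represents \<open>\<I>\<close>, and put \<open>m\<^sub>k(n) = |h(n)(k)|\<close> and
  \<open>\<phi>(A) = sup\<^sub>k \<Sum>\<^sub>n\<^sub>\<in>\<^sub>A m\<^sub>k(n)\<close>. Then \<open>\<I>\<close> is the set of all \<open>A\<close> with \<open>\<phi>(A - N) \<longlonglongrightarrow> 0\<close>. Since
  \<open>\<I>\<close> is \<open>F\<^sub>\<sigma>\<close>, a Baire category argument gives \<open>d > 0\<close> such that \<open>\<phi>(B) \<le> 4d\<close> implies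
  \<open>B \<in> \<I>\<close>; since \<open>\<I>\<close> is tall, \<open>\<phi>({n}) \<longlonglongrightarrow> 0\<close>. If no finite number of the measures \<open>m\<^sub>k\<close>
  controlled \<open>\<phi>\<close> on finite sets far out, then, because \<open>m\<^sub>k(S) \<longlonglongrightarrow> 0\<close> for finite \<open>S\<close>, a gliding
  hump would produce infinitely many disjoint finite sets, each with \<open>\<phi> > d\<close>, whose union has
  \<open>\<phi> \<le> 4d\<close> and so lies in \<open>\<I>\<close>, which is absurd. Hence \<open>\<I>\<close> is the summable ideal of
  \<open>m\<^sub>0 + \<dots> + m\<^sub>K\<^sub>-\<^sub>1\<close> for some \<open>K\<close>. Conversely, a summable ideal is represented by multiples of one
  unit vector.\<close>

section \<open>Cauchy criterion for unconditional sums, and preliminaries\<close>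

text \<open>A finite set \<open>F\<close> beyond a finite \<open>X\<close> whose supersets all have
  sums close to the limit is disjoint from \<open>X\<close>, so \<open>sum f F\<close> is a
  difference of two such sums.\<close>

lemma summable_on_imp_small_tails:
  fixes f :: "nat \<Rightarrow> 'a :: real_normed_vector"
  assumes "f summable_on A" "e > 0"
  shows "\<exists>N. \<forall>F. finite F \<longrightarrow> F \<subseteq> A - {..<N} \<longrightarrow> norm (sum f F) \<le> e"
proof -
  obtain s where s: "(sum f \<longlongrightarrow> s) (finite_subsets_at_top A)"
    using assms(1) unfolding summable_on_def has_sum_def by blast
  have "\<forall>\<^sub>F X in finite_subsets_at_top A. dist (sum f X) s < e / 2"
    using s assms(2) tendstoD half_gt_zero by blast
  then obtain X where X: "finite X" "X \<subseteq> A"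
    and near: "\<And>Y. \<lbrakk>finite Y; X \<subseteq> Y; Y \<subseteq> A\<rbrakk> \<Longrightarrow> dist (sum f Y) s < e / 2"
    unfolding eventually_finite_subsets_at_top by metis
  obtain N where N: "X \<subseteq> {..<N}"
    using X(1) finite_nat_bounded by blast
  have "norm (sum f F) \<le> e" if "finite F" "F \<subseteq> A - {..<N}" for F
  proof -
    have "X \<inter> F = {}"
      using that N by blast
    then have "sum f F = sum f (X \<union> F) - sum f X"
      using X that by (simp add: sum.union_disjoint)
    then have "norm (sum f F) = dist (sum f (X \<union> F)) (sum f X)"
      by (simp add: dist_norm)
    also have "\<dots> \<le> dist (sum f (X \<union> F)) s + dist (sum f X) s"
      by (rule dist_triangle2)
    also have "\<dots> \<le> e"
      using near[of "X \<union> F"] near[of X] X that by fastforce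
    finally show ?thesis .
  qed
  then show ?thesis
    by blast
qed

text \<open>Completeness is an explicit hypothesis so that one statement serves both the reals and
  spaces of bounded continuous functions.\<close>

lemma small_tails_imp_summable_on:
  fixes f :: "nat \<Rightarrow> 'a :: real_normed_vector"
  assumes "complete (UNIV :: 'a set)"
    and C: "\<And>e. e > 0 \<Longrightarrow> \<exists>N. \<forall>F. finite F \<longrightarrow> F \<subseteq> A - {..<N} \<longrightarrow> norm (sum f F) \<le> e"
  shows "f summable_on A"
proof -
  have "\<exists>P. eventually P (finite_subsets_at_top A) \<and>
          (\<forall>X Y. P X \<and> P Y \<longrightarrow> dist (sum f X) (sum f Y) < e)" if "e > 0" for e
  proof -
    obtain N where N: "\<And>F. \<lbrakk>finite F; F \<subseteq> A - {..<N}\<rbrakk> \<Longrightarrow> norm (sum f F) \<le> e / 3"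
      using C[of "e / 3"] \<open>e > 0\<close> by auto
    \<comment> \<open>A finite set between \<open>I\<close> and \<open>A\<close> differs from
      \<open>I\<close> only beyond \<open>N\<close>. Two such sets have sums at most 2e/3 apart,
      whence the strict bound.\<close>
    define I where "I = A \<inter> {..<N}"
    define P where "P X \<longleftrightarrow> finite X \<and> I \<subseteq> X \<and> X \<subseteq> A" for X
    have "eventually P (finite_subsets_at_top A)"
      unfolding eventually_finite_subsets_at_top P_def
      by (rule exI[of _ I]) (auto simp: I_def)
    moreover have near: "norm (sum f X - sum f I) \<le> e / 3" if "P X" for X
    proof -
      have "sum f X - sum f I = sum f (X - I)"
        using that by (simp add: P_def sum_diff)
      then show ?thesis
        using N[of "X - I"] that by (auto simp: P_def I_def)
    qed
    have "dist (sum f X) (sum f Y) < e" if "P X" "P Y" for X Y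
    proof -
      have "dist (sum f X) (sum f Y) \<le> dist (sum f X) (sum f I) + dist (sum f Y) (sum f I)"
        by (rule dist_triangle2)
      also have "\<dots> < e"
        using near[OF that(1)] near[OF that(2)] \<open>e > 0\<close> by (simp add: dist_norm)
      finally show ?thesis .
    qed
    ultimately show ?thesis
      by blast
  qed
  then have "cauchy_filter (filtermap (sum f) (finite_subsets_at_top A))"
    by (simp add: cauchy_filter_metric_filtermap)
  then obtain s where "(sum f \<longlongrightarrow> s) (finite_subsets_at_top A)"
    using assms(1) complete_uniform[where S = UNIV] by (force simp: filterlim_def)
  then show "f summable_on A"
    unfolding summable_on_def has_sum_def by blast
qed

lemma finite_subset_incseq_UN:
  fixes S :: "nat \<Rightarrow> 'a set"
  assumes "finite F" "F \<subseteq> (\<Union>i. S i)" "incseq S"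
  shows "\<exists>i. F \<subseteq> S i"
  using assms(1,2)
proof (induction F)
  case (insert x F)
  then obtain i j where "F \<subseteq> S i" "x \<in> S j"
    by auto
  moreover have "S i \<subseteq> S (max i j)" "S j \<subseteq> S (max i j)"
    using incseqD[OF \<open>incseq S\<close>] by simp_all
  ultimately show ?case
    by blast
qed simp

text \<open>A basic open set of the product restricts only finitely many coordinates; any bound on
  their indices serves as \<open>n\<close>.\<close>

lemma open_fun_discrete_cylinder:
  fixes U :: "(nat \<Rightarrow> 'a :: discrete_topology) set"
  assumes "open U" "f \<in> U"
  shows "\<exists>n. \<forall>g. (\<forall>i<n. g i = f i) \<longrightarrow> g \<in> U"
proof -
  have "openin (product_topology (\<lambda>i. euclidean) UNIV) U"
    using assms(1) by (simp add: open_fun_def)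
  from product_topology_open_contains_basis[OF this assms(2)]
  obtain X where X: "f \<in> Pi\<^sub>E UNIV X" "finite {i. X i \<noteq> UNIV}" "Pi\<^sub>E UNIV X \<subseteq> U"
    by auto
  obtain n where n: "{i. X i \<noteq> UNIV} \<subseteq> {..<n}"
    using X(2) finite_nat_bounded by blast
  have "g \<in> U" if "\<forall>i<n. g i = f i" for g
  proof -
    have "g i \<in> X i" for i
      using n X(1) that by (cases "i < n") (auto simp: PiE_iff)
    then show ?thesis
      using X(3) by auto
  qed
  then show ?thesis
    by blast
qed

section \<open>Submeasures given by families of weights\<close>

text \<open>For a family \<open>m\<close> of nonnegative weights, \<open>mass_le m B e\<close> says \<open>\<phi>(B) \<le> e\<close> for the lower
  semicontinuous submeasure \<open>\<phi>(B) = sup\<^sub>k \<Sum>\<^sub>n\<^sub>\<in>\<^sub>B m\<^sub>k(n)\<close>, and \<open>exh m\<close> is the ideal \<open>Exh(\<phi>)\<close>.\<close>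

definition mass_le :: "('k \<Rightarrow> nat \<Rightarrow> real) \<Rightarrow> nat set \<Rightarrow> real \<Rightarrow> bool" where
  "mass_le m B e \<longleftrightarrow> (\<forall>k F. finite F \<longrightarrow> F \<subseteq> B \<longrightarrow> sum (m k) F \<le> e)"

definition exh :: "('k \<Rightarrow> nat \<Rightarrow> real) \<Rightarrow> nat set set" where
  "exh m = {A. \<forall>e>0. \<exists>N. mass_le m (A - {..<N}) e}"

lemma mass_le_mono:
  assumes "mass_le m B e" "A \<subseteq> B" "e \<le> e'"
  shows "mass_le m A e'"
  unfolding mass_le_def
proof (intro allI impI)
  fix k F
  assume "finite F" "F \<subseteq> A"
  then have "sum (m k) F \<le> e"
    using assms(1,2) unfolding mass_le_def by blast
  then show "sum (m k) F \<le> e'"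
    using assms(3) by linarith
qed

lemma mass_le_empty: "0 \<le> e \<Longrightarrow> mass_le m {} e"
  by (simp add: mass_le_def)

lemma mass_le_Un:
  assumes "mass_le m A a" "mass_le m B b"
  shows "mass_le m (A \<union> B) (a + b)"
  unfolding mass_le_def
proof (intro allI impI)
  fix k F
  assume F: "finite F" "F \<subseteq> A \<union> B"
  have "sum (m k) F = sum (m k) (F \<inter> A) + sum (m k) (F - A)"
    using F(1) by (simp add: sum.Int_Diff)
  also have "\<dots> \<le> a + b"
    using assms F unfolding mass_le_def by (intro add_mono) (simp_all add: Diff_subset_conv)
  finally show "sum (m k) F \<le> a + b" .
qed

lemma mass_le_UN:
  assumes "\<And>i :: nat. mass_le m (S i) e" "incseq S"
  shows "mass_le m (\<Union>i. S i) e"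
  unfolding mass_le_def
proof (intro allI impI)
  fix k F
  assume F: "finite F" "F \<subseteq> (\<Union>i. S i)"
  then obtain i where "F \<subseteq> S i"
    using finite_subset_incseq_UN assms(2) by blast
  then show "sum (m k) F \<le> e"
    using assms(1)[of i] F(1) unfolding mass_le_def by blast
qed

lemma exhD: "A \<in> exh m \<Longrightarrow> e > 0 \<Longrightarrow> \<exists>N. mass_le m (A - {..<N}) e"
  by (simp add: exh_def)

lemma exh_cong_tail:
  assumes "A - {..<n} = B - {..<n}" "A \<in> exh m"
  shows "B \<in> exh m"
proof -
  have "\<exists>N. mass_le m (B - {..<N}) e" if "e > 0" for e
  proof -
    obtain N where "mass_le m (A - {..<N}) e"
      using exhD[OF assms(2) \<open>e > 0\<close>] by blast
    moreover have "B - {..<max n N} = (B - {..<n}) - {..<N}"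
      by auto
    then have "B - {..<max n N} \<subseteq> A - {..<N}"
      unfolding assms(1)[symmetric] by auto
    ultimately have "mass_le m (B - {..<max n N}) e"
      using mass_le_mono by blast
    then show ?thesis ..
  qed
  then show ?thesis
    by (simp add: exh_def)
qed

section \<open>The Baire category argument\<close>

text \<open>Otherwise one builds a member of \<open>exh m\<close> outside each of the closed sets \<open>C j\<close>: a pair
  \<open>(S, n)\<close> stands for the cylinder of sets whose part below \<open>n\<close> is \<open>S\<close>, and stage \<open>j\<close> shrinks it
  to a cylinder missing \<open>C j\<close> while adding mass at most \<open>2\<^sup>-\<^sup>j\<close>.\<close>

lemma F_sigma_exh_bounded_imp_mem:
  assumes "F_sigma_family (exh m)"
  shows "\<exists>e>0. \<forall>B. mass_le m B e \<longrightarrow> B \<in> exh m"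
proof (rule ccontr)
  assume "\<not> ?thesis"
  then have bad: "\<exists>B. mass_le m B e \<and> B \<notin> exh m" if "e > 0" for e
    using that by blast
  define ind :: "nat set \<Rightarrow> nat \<Rightarrow> bool" where "ind A = (\<lambda>n. n \<in> A)" for A
  have "inj ind"
    by (auto simp: inj_def ind_def fun_eq_iff)
  obtain C where C: "\<And>j :: nat. closed (C j)" and exh_C: "ind ` exh m = (\<Union>j. C j)"
    using assms unfolding F_sigma_family_def fsigma.simps ind_def by metis
  define step where "step j p q \<longleftrightarrow>
      fst p \<subseteq> fst q \<and> snd p < snd q \<and> fst q \<inter> {..<snd p} = fst p \<and>
      mass_le m (fst q - {..<snd p}) ((1/2) ^ j) \<and>
      (\<forall>T. T \<inter> {..<snd q} = fst q \<longrightarrow> ind T \<notin> C j)"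
    for j :: nat and p q :: "nat set \<times> nat"
  have ex_step: "\<exists>q. fst q \<subseteq> {..<snd q} \<and> step j p q" if "fst p \<subseteq> {..<snd p}" for p j
  proof -
    obtain B where B: "mass_le m B ((1/2) ^ j)" "B \<notin> exh m"
      using bad[of "(1/2) ^ j"] by auto
    \<comment> \<open>The bad set \<open>B\<close> gets \<open>fst p\<close> as its part below
      \<open>snd p\<close>. Finite changes do not affect membership in \<open>exh m\<close>, so
      \<open>B'\<close> avoids \<open>C j\<close>, and a whole cylinder around \<open>B'\<close>
      does so too.\<close>
    define B' where "B' = fst p \<union> (B - {..<snd p})"
    have tail: "B' - {..<snd p} = B - {..<snd p}"
      using that by (auto simp: B'_def)
    then have "B' \<notin> exh m"
      using B(2) exh_cong_tail by blast
    then have "ind B' \<notin> C j"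
      using exh_C \<open>inj ind\<close> by (metis UN_I UNIV_I inj_image_mem_iff)
    then obtain n where n: "\<And>g. (\<forall>i<n. g i = ind B' i) \<Longrightarrow> g \<in> - C j"
      using open_fun_discrete_cylinder[of "- C j" "ind B'"] C[of j] by (auto simp: open_Compl)
    define n' where "n' = max n (Suc (snd p))"
    have "ind T \<notin> C j" if T: "T \<inter> {..<n'} = B' \<inter> {..<n'}" for T
    proof -
      have "i \<in> T \<longleftrightarrow> i \<in> B'" if "i < n'" for i
        using T that by blast
      then show ?thesis
        using n[of "ind T"] by (auto simp: ind_def n'_def)
    qed
    moreover have "mass_le m (B' \<inter> {..<n'} - {..<snd p}) ((1/2) ^ j)"
      using B(1) by (rule mass_le_mono) (use tail in auto)
    moreover have "fst p \<subseteq> B' \<inter> {..<n'}" "B' \<inter> {..<n'} \<inter> {..<snd p} = fst p"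
      using \<open>fst p \<subseteq> {..<snd p}\<close> by (auto simp: n'_def B'_def)
    moreover have "snd p < n'"
      by (simp add: n'_def)
    ultimately have "step j p (B' \<inter> {..<n'}, n')"
      unfolding step_def by simp
    then show ?thesis
      by (metis fst_conv snd_conv Int_lower2)
  qed
  obtain p where p: "\<And>j. fst (p j) \<subseteq> {..<snd (p j)}" "\<And>j. step j (p j) (p (Suc j))"
    using dependent_nat_choice[of "\<lambda>_ p. fst p \<subseteq> {..<snd p}" step] ex_step
    by (metis empty_subsetI fst_conv)
  define S n where "S j = fst (p j)" and "n j = snd (p j)" for j
  have S: "S j \<subseteq> S (Suc j)" "S (Suc j) \<inter> {..<n j} = S j"
      "mass_le m (S (Suc j) - {..<n j}) ((1/2) ^ j)"
      "T \<inter> {..<n (Suc j)} = S (Suc j) \<Longrightarrow> ind T \<notin> C j" for j T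
    using p(2)[of j] by (auto simp: step_def S_def n_def)
  have Sn: "S j \<subseteq> {..<n j}" for j
    using p(1) by (simp add: S_def n_def)
  have "incseq S"
    using S(1) by (rule incseq_SucI)
  have "incseq n"
    using p(2) by (intro incseq_SucI) (auto simp: step_def n_def less_imp_le)
  define A where "A = (\<Union>j. S j)"
  \<comment> \<open>Later stages add nothing below an earlier cutoff, so the union \<open>A\<close>
    will lie in every cylinder.\<close>
  have S_Int: "S i \<inter> {..<n j} \<subseteq> S j" for i j
  proof (induction i)
    case 0
    show ?case
      using incseqD[OF \<open>incseq S\<close>, of 0 j] by blast
  next
    case (Suc i)
    show ?case
    proof (cases "j \<le> i")
      case True
      then have "n j \<le> n i"
        using \<open>incseq n\<close> by (simp add: incseqD)
      then have "S (Suc i) \<inter> {..<n j} \<subseteq> S i \<inter> {..<n j}"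
        using S(2)[of i] by fastforce
      then show ?thesis
        using Suc by blast
    next
      case False
      then show ?thesis
        using incseqD[OF \<open>incseq S\<close>, of "Suc i" j] by auto
    qed
  qed
  have A_Int: "A \<inter> {..<n j} = S j" for j
    using S_Int Sn by (fastforce simp: A_def)
  \<comment> \<open>The bound is the sum of (1/2)^l over j \<le> l < i in closed form; each stage
    contributes one term.\<close>
  have tail: "mass_le m (S i - {..<n j}) (2 * (1/2) ^ j - 2 * (1/2) ^ i)" if "j \<le> i" for i j
    using that
  proof (induction i rule: dec_induct)
    case base
    have "S j - {..<n j} = {}"
      using Sn by blast
    then show ?case
      by (simp only: mass_le_empty diff_self order_refl)
  next
    case (step i)
    have "S (Suc i) - {..<n j} \<subseteq> (S i - {..<n j}) \<union> (S (Suc i) - {..<n i})"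
      using S(2)[of i] by blast
    then show ?case
      using mass_le_mono[OF mass_le_Un[OF step.IH S(3)[of i]]] by simp
  qed
  have "A \<in> exh m"
    unfolding exh_def
  proof (intro CollectI allI impI)
    fix e :: real
    assume "e > 0"
    then obtain j where j: "(1/2 :: real) ^ j < e / 2"
      using real_arch_pow_inv[of "e / 2" "1/2"] by auto
    have "mass_le m (S i - {..<n j}) e" for i
    proof -
      \<comment> \<open>Passing to \<open>max i j\<close> also covers the stages before
        \<open>j\<close>.\<close>
      have "mass_le m (S (max i j) - {..<n j}) (2 * (1/2) ^ j - 2 * (1/2) ^ max i j)"
        by (rule tail) simp
      moreover have "2 * (1/2) ^ j - 2 * (1/2) ^ max i j \<le> e"
        using j zero_le_power[of "1/2 :: real" "max i j"] by linarith
      moreover have "S i - {..<n j} \<subseteq> S (max i j) - {..<n j}"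
        using incseqD[OF \<open>incseq S\<close>, of i "max i j"] by auto
      ultimately show ?thesis
        using mass_le_mono by blast
    qed
    moreover have "incseq (\<lambda>i. S i - {..<n j})"
      using \<open>incseq S\<close> by (auto simp: incseq_def)
    ultimately have "mass_le m (\<Union>i. S i - {..<n j}) e"
      by (rule mass_le_UN)
    moreover have "(\<Union>i. S i - {..<n j}) = A - {..<n j}"
      by (auto simp: A_def)
    ultimately show "\<exists>N. mass_le m (A - {..<N}) e"
      by auto
  qed
  then obtain j where "ind A \<in> C j"
    using exh_C by blast
  then show False
    using S(4) A_Int by blast
qed

section \<open>Small atoms and the gliding hump\<close>

text \<open>Otherwise tallness gives an infinite member of \<open>exh m\<close> made of points of
  mass above \<open>d\<close>, and each of its tails still contains such a point.\<close>

lemma tall_exh_imp_atoms_small: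
  assumes "tall (exh m)" "d > 0"
  shows "\<exists>N. \<forall>n\<ge>N. \<forall>k. m k n \<le> d"
proof (rule ccontr)
  assume "\<not> ?thesis"
  then have "infinite {n. \<exists>k. m k n > d}"
    unfolding infinite_nat_iff_unbounded_le by (auto simp: not_le)
  then obtain Y where Y: "Y \<in> exh m" "infinite Y" "Y \<subseteq> {n. \<exists>k. m k n > d}"
    using assms(1) by (auto simp: tall_def)
  obtain N where N: "mass_le m (Y - {..<N}) d"
    using exhD[OF Y(1) assms(2)] by blast
  obtain n where n: "n \<ge> N" "n \<in> Y"
    using Y(2) by (auto simp: infinite_nat_iff_unbounded_le)
  then obtain k where "m k n > d"
    using Y(3) by auto
  moreover have "sum (m k) {n} \<le> d"
    using N n unfolding mass_le_def by (metis Diff_iff empty_subsetI finite.emptyI finite_insert insert_subset lessThan_iff not_le)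
  ultimately show False
    by simp
qed

text \<open>When points are added one at a time, the mass first passes \<open>d\<close> by a jump of
  at most \<open>d\<close>.\<close>

lemma subset_of_moderate_mass:
  assumes "finite F" "\<And>n k. n \<in> F \<Longrightarrow> m k n \<le> d" "\<not> mass_le m F d" "d \<ge> 0"
  shows "\<exists>G\<subseteq>F. \<not> mass_le m G d \<and> mass_le m G (2 * d)"
  using assms(1-3)
proof (induction F)
  case empty
  then show ?case
    using \<open>d \<ge> 0\<close> by (simp add: mass_le_empty)
next
  case (insert x F)
  show ?case
  proof (cases "mass_le m F d")
    case True
    have "mass_le m {x} d"
      unfolding mass_le_def using insert.prems(1)[of x] \<open>d \<ge> 0\<close>
      by (auto simp: subset_singleton_iff)
    from mass_le_Un[OF this True] show ?thesis
      using insert.prems(2) by (intro exI[of _ "insert x F"]) auto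
  next
    case False
    then obtain G where "G \<subseteq> F" "\<not> mass_le m G d" "mass_le m G (2 * d)"
      using insert by (metis insertI2)
    then show ?thesis
      by blast
  qed
qed

lemma mass_controlled_by_finitely_many:
  fixes m :: "nat \<Rightarrow> nat \<Rightarrow> real"
  assumes nonneg: "\<And>k n. 0 \<le> m k n"
    and null: "\<And>n. (\<lambda>k. m k n) \<longlonglongrightarrow> 0"
    and atoms: "\<And>d. d > 0 \<Longrightarrow> \<exists>N. \<forall>n\<ge>N. \<forall>k. m k n \<le> d"
    and mem: "\<And>B. mass_le m B (4 * d) \<Longrightarrow> B \<in> exh m"
    and "d > 0"
  shows "\<exists>K. \<exists>r>0. \<exists>N. \<forall>F. finite F \<longrightarrow> F \<subseteq> {N..} \<longrightarrow> (\<forall>k<K. sum (m k) F < r) \<longrightarrow> mass_le m F d"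
proof (rule ccontr)
  assume "\<not> ?thesis"
  then have bad: "\<exists>F. finite F \<and> F \<subseteq> {N..} \<and> (\<forall>k<K. sum (m k) F < r) \<and> \<not> mass_le m F d"
    if "r > 0" for K r N
    using that by simp
  obtain N0 where N0: "\<And>n k. n \<ge> N0 \<Longrightarrow> m k n \<le> d"
    using atoms[OF \<open>d > 0\<close>] by blast
  \<comment> \<open>The bound is strict so that each stage can spend part of the slack below
    \<open>4 * d\<close> and leave some for the next.\<close>
  define good where "good S \<longleftrightarrow> finite S \<and> (\<exists>b<4 * d. mass_le m S b)" for S
  have step: "\<exists>S'. good S' \<and> S \<subseteq> S' \<and> \<not> mass_le m (S' - {..<N}) d" if "good S" for S N
  proof -
    obtain b where b: "finite S" "b < 4 * d" "mass_le m S b"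
      using \<open>good S\<close> by (auto simp: good_def)
    \<comment> \<open>From \<open>K\<close> on the old set \<open>S\<close> weighs less than
      \<open>d\<close>, so a hump of mass at most \<open>2 * d\<close> keeps the total below
      \<open>3 * d\<close>. Before \<open>K\<close> the hump weighs less than \<open>r\<close>, half
      of the remaining slack.\<close>
    have "(\<lambda>k. sum (m k) S) \<longlonglongrightarrow> (\<Sum>n\<in>S. 0)"
      by (intro tendsto_sum null)
    then have "\<forall>\<^sub>F k in sequentially. sum (m k) S < d"
      using \<open>d > 0\<close> by (auto intro: order_tendstoD)
    then obtain K where K: "\<And>k. k \<ge> K \<Longrightarrow> sum (m k) S < d"
      by (auto simp: eventually_sequentially)
    define r where "r = (4 * d - b) / 2"
    have "r > 0"
      using b by (simp add: r_def)
    then obtain F where F: "finite F" "F \<subseteq> {max N N0..}" "\<And>k. k < K \<Longrightarrow> sum (m k) F < r"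
        "\<not> mass_le m F d"
      using bad by meson
    obtain G where G: "G \<subseteq> F" "\<not> mass_le m G d" "mass_le m G (2 * d)"
      using subset_of_moderate_mass[of F m d] F N0 \<open>d > 0\<close> by fastforce
    have "mass_le m (S \<union> G) (max (3 * d) (b + r))"
      unfolding mass_le_def
    proof (intro allI impI)
      fix k H
      assume H: "finite H" "H \<subseteq> S \<union> G"
      have split: "sum (m k) H = sum (m k) (H \<inter> S) + sum (m k) (H - S)"
        using H(1) by (simp add: sum.Int_Diff)
      show "sum (m k) H \<le> max (3 * d) (b + r)"
      proof (cases "k < K")
        case True
        have "sum (m k) (H \<inter> S) \<le> b"
          using b(3) H(1) unfolding mass_le_def by auto
        moreover have "sum (m k) (H - S) \<le> sum (m k) F"
          using H(2) G(1) F(1) nonneg by (intro sum_mono2) auto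
        ultimately show ?thesis
          using split F(3)[OF True] by linarith
      next
        case False
        have "sum (m k) (H \<inter> S) \<le> sum (m k) S"
          using b(1) nonneg by (intro sum_mono2) auto
        moreover have "sum (m k) (H - S) \<le> 2 * d"
          using G(3) H unfolding mass_le_def by (metis Diff_subset_conv finite_Diff)
        ultimately show ?thesis
          using split K[of k] False by simp
      qed
    qed
    moreover have "max (3 * d) (b + r) < 4 * d"
      using b(2) \<open>d > 0\<close> by (simp add: r_def field_simps)
    moreover have "finite (S \<union> G)"
      using b(1) F(1) G(1) finite_subset by blast
    ultimately have "good (S \<union> G)"
      unfolding good_def by blast
    moreover have "G \<subseteq> (S \<union> G) - {..<N}"
      using G(1) F(2) by auto
    then have "\<not> mass_le m ((S \<union> G) - {..<N}) d"
      using G(2) mass_le_mono by blast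
    ultimately show ?thesis
      by blast
  qed
  have "good {}"
    using \<open>d > 0\<close> by (auto simp: good_def intro!: exI[of _ 0] mass_le_empty)
  then obtain S where S: "\<And>N. good (S N)"
      "\<And>N. S N \<subseteq> S (Suc N) \<and> \<not> mass_le m (S (Suc N) - {..<N}) d"
    using dependent_nat_choice[of "\<lambda>_. good"
        "\<lambda>N S S'. S \<subseteq> S' \<and> \<not> mass_le m (S' - {..<N}) d"] step
    by metis
  have "incseq S"
    using S(2) by (auto intro: incseq_SucI)
  moreover have "mass_le m (S N) (4 * d)" for N
    using S(1)[of N] mass_le_mono unfolding good_def by (metis less_imp_le order_refl)
  ultimately have "(\<Union>N. S N) \<in> exh m"
    by (intro mem mass_le_UN)
  \<comment> \<open>As a member of \<open>exh m\<close> the union has a tail of mass at most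
    \<open>d\<close>, but stage \<open>N\<close> put mass above \<open>d\<close> beyond
    \<open>N\<close>.\<close>
  then obtain N where N: "mass_le m ((\<Union>N. S N) - {..<N}) d"
    using exhD \<open>d > 0\<close> by blast
  have "mass_le m (S (Suc N) - {..<N}) d"
    by (rule mass_le_mono[OF N]) auto
  then show False
    using S(2) by blast
qed

section \<open>From finitely many weights to a summable ideal\<close>

lemma exh_imp_summable_on:
  assumes "\<And>k n. 0 \<le> m k n" "A \<in> exh m"
  shows "m k summable_on A"
proof (rule small_tails_imp_summable_on)
  show "complete (UNIV :: real set)"
    by (simp add: complete_eq_closed)
  fix e :: real
  assume "e > 0"
  then obtain N where "mass_le m (A - {..<N}) e"
    using exhD[OF assms(2)] by blast
  then show "\<exists>N. \<forall>F. finite F \<longrightarrow> F \<subseteq> A - {..<N} \<longrightarrow> norm (sum (m k) F) \<le> e"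
    using assms(1) unfolding mass_le_def by (intro exI[of _ N]) (auto simp: sum_nonneg)
qed

text \<open>By the category argument, a single tail of mass at most \<open>4 * d\<close> already
  puts a set into \<open>exh m\<close>. Such a tail exists once the first \<open>K\<close> weights
  have small tails on the set.\<close>

lemma exh_eq_summable:
  fixes m :: "nat \<Rightarrow> nat \<Rightarrow> real"
  assumes nonneg: "\<And>k n. 0 \<le> m k n"
    and null: "\<And>n. (\<lambda>k. m k n) \<longlonglongrightarrow> 0"
    and "F_sigma_family (exh m)" "tall (exh m)"
  shows "\<exists>K. exh m = {A. (\<lambda>n. \<Sum>k<K. m k n) summable_on A}"
proof -
  obtain e where e: "e > 0" "\<And>B. mass_le m B e \<Longrightarrow> B \<in> exh m"
    using F_sigma_exh_bounded_imp_mem[OF assms(3)] by blast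
  define d where "d = e / 4"
  have "d > 0"
    using e(1) by (simp add: d_def)
  have d: "B \<in> exh m" if "mass_le m B (4 * d)" for B
    using e(2)[of B] that by (simp add: d_def)
  obtain K r N where "r > 0" and control:
      "\<And>F. \<lbrakk>finite F; F \<subseteq> {N..}; \<forall>k<K. sum (m k) F < r\<rbrakk> \<Longrightarrow> mass_le m F d"
    using mass_controlled_by_finitely_many[OF nonneg null tall_exh_imp_atoms_small[OF assms(4)] d \<open>d > 0\<close>]
    by blast
  let ?f = "\<lambda>n. \<Sum>k<K. m k n"
  have "A \<in> exh m" if A: "?f summable_on A" for A
  proof -
    \<comment> \<open>Half of \<open>r\<close>, since the tail bound is not strict while
      \<open>control\<close> asks for a strict one.\<close>
    have "r / 2 > 0"
      using \<open>r > 0\<close> by simp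
    then obtain N' where N': "\<And>F. \<lbrakk>finite F; F \<subseteq> A - {..<N'}\<rbrakk> \<Longrightarrow> norm (sum ?f F) \<le> r / 2"
      using summable_on_imp_small_tails[OF A] by meson
    define n where "n = max N N'"
    have small: "mass_le m F d" if F: "finite F" "F \<subseteq> A - {..<n}" for F
    proof (rule control)
      show "\<forall>k<K. sum (m k) F < r"
      proof (intro allI impI)
        fix k
        assume "k < K"
        then have "sum (m k) F \<le> sum ?f F"
          using nonneg by (intro sum_mono member_le_sum) auto
        also have "\<dots> \<le> norm (sum ?f F)"
          by simp
        also have "\<dots> \<le> r / 2"
          using F by (intro N') (auto simp: n_def)
        finally show "sum (m k) F < r"
          using \<open>r > 0\<close> by simp
      qed
    qed (use F in \<open>auto simp: n_def\<close>)
    have "mass_le m (A - {..<n}) d"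
      unfolding mass_le_def
    proof (intro allI impI)
      fix k F
      assume F: "finite F" "F \<subseteq> A - {..<n}"
      then show "sum (m k) F \<le> d"
        using small[OF F] unfolding mass_le_def by blast
    qed
    then have "mass_le m (A - {..<n}) (4 * d)"
      by (rule mass_le_mono) (use \<open>d > 0\<close> in auto)
    then have "A - {..<n} \<in> exh m"
      by (rule d)
    then show ?thesis
      by (rule exh_cong_tail[of _ n, rotated]) auto
  qed
  moreover have "?f summable_on A" if "A \<in> exh m" for A
    by (induction K) (simp_all add: summable_on_add exh_imp_summable_on[OF nonneg that])
  ultimately show ?thesis
    by blast
qed

section \<open>Unconditional convergence in c0\<close>

text \<open>The library proves this only over a metric domain, and \<open>nat\<close> is not an instance of that
  class.\<close>

lemma complete_UNIV_bcontfun: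
  "complete (UNIV :: ('a :: topological_space \<Rightarrow>\<^sub>C 'b :: complete_space) set)"
  unfolding complete_def
proof (intro allI impI)
  fix f :: "nat \<Rightarrow> 'a \<Rightarrow>\<^sub>C 'b"
  assume "(\<forall>n. f n \<in> UNIV) \<and> Cauchy f"
  then have f: "Cauchy f"
    by simp
  have "\<exists>N. \<forall>m n x. N \<le> m \<and> N \<le> n \<longrightarrow> dist (apply_bcontfun (f m) x) (apply_bcontfun (f n) x) < e"
    if "e > 0" for e
    using f that unfolding Cauchy_def by (meson dist_bounded le_less_trans)
  then obtain g where "uniform_limit UNIV (\<lambda>n. apply_bcontfun (f n)) g sequentially"
    using uniformly_convergent_eq_cauchy[of "\<lambda>_. True" "\<lambda>n. apply_bcontfun (f n)"]
    unfolding uniform_limit_sequentially_iff by auto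
  from uniform_limit_bcontfunE[OF this sequentially_bot]
  obtain l where "f \<longlonglongrightarrow> l"
    by metis
  then show "\<exists>l\<in>UNIV. f \<longlonglongrightarrow> l"
    by blast
qed

lemma apply_bcontfun_sum:
  fixes h :: "'i \<Rightarrow> 'a :: topological_space \<Rightarrow>\<^sub>C 'b :: real_normed_vector"
  shows "apply_bcontfun (sum h F) x = (\<Sum>i\<in>F. apply_bcontfun (h i) x)"
  by (induction F rule: infinite_finite_induct) auto

text \<open>A finite partial sum within e/2 of \<open>s\<close> is itself a null sequence. This lets
  \<open>uncond_convergent_c0\<close> be read as \<open>summable_on\<close>.\<close>

lemma has_sum_in_c0:
  assumes "range h \<subseteq> c0" "(h has_sum s) A"
  shows "s \<in> c0"
proof -
  have "\<forall>\<^sub>F k in sequentially. dist (apply_bcontfun s k) 0 < e" if "e > 0" for e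
  proof -
    obtain F where F: "dist (sum h F) s \<le> e / 2"
      using has_sum_finite_approximation[OF assms(2), of "e / 2"] \<open>e > 0\<close> by auto
    have "(\<lambda>k. \<Sum>i\<in>F. apply_bcontfun (h i) k) \<longlonglongrightarrow> (\<Sum>i\<in>F. 0)"
      using assms(1) by (intro tendsto_sum) (auto simp: c0_def)
    then have "\<forall>\<^sub>F k in sequentially. dist (apply_bcontfun (sum h F) k) 0 < e / 2"
      using \<open>e > 0\<close> unfolding apply_bcontfun_sum sum.neutral_const by (intro tendstoD) auto
    then show ?thesis
    proof eventually_elim
      case (elim k)
      have "dist (apply_bcontfun (sum h F) k) (apply_bcontfun s k) \<le> e / 2"
        using dist_bounded[of "sum h F" k s] F by linarith
      with elim show ?case
        using dist_triangle3[of "apply_bcontfun s k" 0 "apply_bcontfun (sum h F) k"] by linarith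
    qed
  qed
  then show ?thesis
    by (simp add: c0_def tendsto_iff)
qed

lemma uncond_convergent_c0_iff_summable_on:
  assumes "range h \<subseteq> c0"
  shows "uncond_convergent_c0 h A \<longleftrightarrow> h summable_on A"
  using has_sum_in_c0[OF assms] by (auto simp: uncond_convergent_c0_def summable_on_def)

text \<open>Small tails bound the signed sums over all subsets; splitting a finite set by the sign
  of a coordinate turns the bound e/2 into e for absolute values. Conversely, coordinatewise
  absolute sums bound the sup norm.\<close>

lemma summable_on_bcontfun_iff_exh:
  fixes h :: "nat \<Rightarrow> 'k :: topological_space \<Rightarrow>\<^sub>C real"
  shows "h summable_on A \<longleftrightarrow> A \<in> exh (\<lambda>k n. \<bar>apply_bcontfun (h n) k\<bar>)"
proof
  assume "h summable_on A"
  show "A \<in> exh (\<lambda>k n. \<bar>apply_bcontfun (h n) k\<bar>)"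
    unfolding exh_def
  proof (intro CollectI allI impI)
    fix e :: real
    assume "e > 0"
    then have "e / 2 > 0"
      by simp
    then obtain N where N: "\<And>F. \<lbrakk>finite F; F \<subseteq> A - {..<N}\<rbrakk> \<Longrightarrow> norm (sum h F) \<le> e / 2"
      using summable_on_imp_small_tails[OF \<open>h summable_on A\<close>] by meson
    have "(\<Sum>n\<in>F. \<bar>apply_bcontfun (h n) k\<bar>) \<le> e" if F: "finite F" "F \<subseteq> A - {..<N}" for F k
    proof -
      have "norm (\<Sum>n\<in>G. apply_bcontfun (h n) k) \<le> e / 2" if "G \<subseteq> F" for G
      proof -
        have "norm (sum h G) \<le> e / 2"
          using F that by (intro N) (auto intro: finite_subset)
        then show ?thesis
          using norm_bounded[of "sum h G" k] by (simp add: apply_bcontfun_sum)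
      qed
      then show ?thesis
        using sum_norm_allsubsets_bound[OF F(1), of "\<lambda>n. apply_bcontfun (h n) k" "e / 2"] by simp
    qed
    then show "\<exists>N. mass_le (\<lambda>k n. \<bar>apply_bcontfun (h n) k\<bar>) (A - {..<N}) e"
      unfolding mass_le_def by blast
  qed
next
  assume A: "A \<in> exh (\<lambda>k n. \<bar>apply_bcontfun (h n) k\<bar>)"
  show "h summable_on A"
  proof (rule small_tails_imp_summable_on[OF complete_UNIV_bcontfun])
    fix e :: real
    assume "e > 0"
    then obtain N where N: "mass_le (\<lambda>k n. \<bar>apply_bcontfun (h n) k\<bar>) (A - {..<N}) e"
      using exhD[OF A] by blast
    have "norm (sum h F) \<le> e" if "finite F" "F \<subseteq> A - {..<N}" for F
    proof (rule norm_bound)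
      fix k
      have "norm (apply_bcontfun (sum h F) k) \<le> (\<Sum>n\<in>F. \<bar>apply_bcontfun (h n) k\<bar>)"
        by (simp add: apply_bcontfun_sum sum_abs)
      also have "\<dots> \<le> e"
        using N that unfolding mass_le_def by blast
      finally show "norm (apply_bcontfun (sum h F) k) \<le> e" .
    qed
    then show "\<exists>N. \<forall>F. finite F \<longrightarrow> F \<subseteq> A - {..<N} \<longrightarrow> norm (sum h F) \<le> e"
      by blast
  qed
qed

lemma c0_ideal_eq_exh:
  assumes "range h \<subseteq> c0"
  shows "c0_ideal h = exh (\<lambda>k n. \<bar>apply_bcontfun (h n) k\<bar>)"
  using uncond_convergent_c0_iff_summable_on[OF assms] summable_on_bcontfun_iff_exh[of h]
  by (auto simp: c0_ideal_def)

section \<open>The two implications\<close>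

lemma summable_ideal_imp_representable_in_c0:
  assumes "summable_ideal \<I>"
  shows "representable_in_c0 \<I>"
proof -
  obtain m :: "nat \<Rightarrow> real" where m: "\<not> m summable_on UNIV" "\<I> = {A. m summable_on A}"
    using assms by (auto simp: summable_ideal_def)
  \<comment> \<open>All \<open>h n\<close> are multiples of the unit vector \<open>u\<close>.
    Evaluation at 0 and scaling of \<open>u\<close> are bounded linear, so they carry summability in
    both directions.\<close>
  define u :: "nat \<Rightarrow> real" where "u k = (if k = 0 then 1 else 0)" for k
  have "u \<longlonglongrightarrow> 0"
    by (rule tendsto_eventually) (auto simp: u_def eventually_sequentially intro!: exI[of _ 1])
  note u = null_sequence_in_c0[OF this]
  define h where "h n = m n *\<^sub>R Bcontfun u" for n
  have h: "apply_bcontfun (h n) k = m n * u k" for n k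
    by (simp add: h_def u(2))
  have "h n \<in> c0" for n
    using tendsto_mult_right_zero[OF \<open>u \<longlonglongrightarrow> 0\<close>, of "m n"] by (simp add: c0_def h[abs_def])
  then have range: "range h \<subseteq> c0"
    by blast
  have "h summable_on A \<longleftrightarrow> m summable_on A" for A
  proof
    assume "h summable_on A"
    moreover have "bounded_linear (\<lambda>x :: nat \<Rightarrow>\<^sub>C real. apply_bcontfun x 0)"
      by (rule bounded_linear_intro[of _ 1]) (simp_all add: norm_bounded del: real_norm_def)
    ultimately have "(\<lambda>n. apply_bcontfun (h n) 0) summable_on A"
      using summable_on_bounded_linear by blast
    then show "m summable_on A"
      by (simp add: h u_def)
  next
    assume "m summable_on A"
    then show "h summable_on A"
      unfolding h_def by (rule summable_on_bounded_linear[OF bounded_linear_scaleR_left])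
  qed
  then have "\<not> uncond_convergent_c0 h UNIV" "\<I> = c0_ideal h"
    using m by (simp_all add: c0_ideal_def uncond_convergent_c0_iff_summable_on[OF range])
  then show ?thesis
    using range unfolding representable_in_c0_def by blast
qed

lemma representable_in_c0_imp_summable_ideal:
  assumes "ideal_on_omega \<I>" "F_sigma_family \<I>" "tall \<I>" "representable_in_c0 \<I>"
  shows "summable_ideal \<I>"
proof -
  obtain h where h: "range h \<subseteq> c0" "\<I> = c0_ideal h"
    using assms(4) by (auto simp: representable_in_c0_def)
  define m where "m k n = \<bar>apply_bcontfun (h n) k\<bar>" for k n
  have \<I>: "\<I> = exh m"
    using c0_ideal_eq_exh[OF h(1)] h(2) by (simp add: m_def[abs_def])
  have "(\<lambda>k. m k n) \<longlonglongrightarrow> 0" for n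
    using h(1) unfolding m_def by (intro tendsto_rabs_zero) (auto simp: c0_def)
  moreover have nonneg: "0 \<le> m k n" for k n
    by (simp add: m_def)
  ultimately obtain K where K: "\<I> = {A. (\<lambda>n. \<Sum>k<K. m k n) summable_on A}"
    using exh_eq_summable[of m] assms(2,3) unfolding \<I> by blast
  \<comment> \<open>Properness of the ideal supplies the divergence of the total sum.\<close>
  moreover have "UNIV \<notin> \<I>"
    using assms(1) by (simp add: ideal_on_omega_def)
  ultimately show ?thesis
    unfolding summable_ideal_def
    by (intro exI[of _ "\<lambda>n. \<Sum>k<K. m k n"]) (auto simp: nonneg sum_nonneg)
qed

theorem theorem6p6:
  fixes \<I> :: "nat set set"
  assumes "ideal_on_omega \<I>"
    and "F_sigma_family \<I>"
    and "P_ideal \<I>"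
    and "tall \<I>"
  shows "representable_in_c0 \<I> \<longleftrightarrow> summable_ideal \<I>"
  using assms representable_in_c0_imp_summable_ideal summable_ideal_imp_representable_in_c0 by blast

end
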